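(* Let $\{X_t\}_{t\in\mathbb{Z}}$ be a FIEGARCH$(p,d,q)$ process, let $n\in\mathbb{N}$ and $\mathcal{F}_n=\sigma(\{Z_t\}_{t\le n})$. Then the $h$-step ahead forecast $\widehat{\ln}(\sigma_{n+h}^2):=\mathbb{E}(\ln(\sigma_{n+h}^2)\mid\mathcal{F}_n)$ is given by $$\widehat{\ln}(\sigma_{n+h}^2)=\omega+\sum_{k=0}^\infty\lambda_{d,k+h-1}\,g(Z_{n-k}),\qquad\text{for all integers }h>0.$$ Moreover, the mean square error of forecast $\mathbb{E}\big([\ln(\sigma_{n+h}^2)-\widehat{\ln}(\sigma_{n+h}^2)]^2\big)$ equals $0$ if $h=1$, and $$\mathbb{E}\big([\ln(\sigma_{n+h}^2)-\widehat{\ln}(\sigma_{n+h}^2)]^2\big)=\sigma_g^2\sum_{k=0}^{h-2}\lambda_{d,k}^2\quad\text{if }h\ge2,$$ where $\sigma_g^2:=\mathbb{E}([g(Z_0)]^2)=\theta^2+\gamma^2-[\gamma\,\mathbb{E}(|Z_0|)]^2+2\theta\gamma\,\mathbb{E}(Z_0|Z_0|)$.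
   Context: FIEGARCH$(p,d,q)$: let $\{Z_t\}_{t\in\mathbb{Z}}$ be i.i.d. real random variables with mean $0$ and variance $1$; let $d,\omega,\theta,\gamma\in\mathbb{R}$; let $\alpha(z)=1-\sum_{i=1}^p\alpha_iz^i$, $\beta(z)=1-\sum_{j=1}^q\beta_jz^j$ be real polynomials with no common roots and $\beta(z)\neq0$ for $|z|\le1$. Let $\lambda_{d,k}$ be defined by $\frac{\alpha(z)}{\beta(z)}(1-z)^{-d}=\sum_{k=0}^\infty\lambda_{d,k}z^k$ for $|z|<1$, and put $g(Z_t)=\theta Z_t+\gamma\,[\,|Z_t|-\mathbb{E}(|Z_t|)\,]$. Then $X_t=\sigma_tZ_t$ with $\sigma_t>0$ given by $$\ln(\sigma_t^2)=\omega+\sum_{k=0}^\infty\lambda_{d,k}\,g(Z_{t-1-k}),\qquad t\in\mathbb{Z},$$ where the process is assumed well defined, i.e. the series converges almost surely to a finite limit. *)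

theory Defs
  imports "HOL-Probability.Probability"
begin

definition lag_poly :: "nat \<Rightarrow> (nat \<Rightarrow> real) \<Rightarrow> complex \<Rightarrow> complex" where
  "lag_poly m c z = 1 - (\<Sum>i=1..m. complex_of_real (c i) * z ^ i)"

text \<open>The argument is a random variable (not a real number), since the function is centred by the mean
  of the modulus of that variable.\<close>

definition news_impact :: "'a measure \<Rightarrow> real \<Rightarrow> real \<Rightarrow> ('a \<Rightarrow> real) \<Rightarrow> 'a \<Rightarrow> real" where
  "news_impact M \<theta> \<gamma> V x = \<theta> * V x + \<gamma> * (\<bar>V x\<bar> - (\<integral>y. \<bar>V y\<bar> \<partial>M))"

text \<open>The assumption \<open>coefficients\<close> determines \<open>lam\<close> uniquely: a power series is determined by
  its sum on the unit disc. For \<open>\<bar>z\<bar> < 1\<close> the number \<open>1 - z\<close> has positive real part, so the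
  principal branch of the power is the analytic one with value 1 at \<open>z = 0\<close>.
  The assumption \<open>log_volatility\<close> contains the almost sure convergence of the series.\<close>

locale fiegarch = prob_space M
  for M :: "'a measure" +
  fixes p :: nat and d :: real and q :: nat
    and \<omega> \<theta> \<gamma> :: real
    and a b :: "nat \<Rightarrow> real"
    and lam :: "nat \<Rightarrow> real"
    and Z \<sigma> X :: "int \<Rightarrow> 'a \<Rightarrow> real"
  assumes independent: "indep_vars (\<lambda>_. borel) Z UNIV"
    and identically_distributed: "\<And>s t. distr M borel (Z s) = distr M borel (Z t)"
    and integrable_Z: "\<And>t. integrable M (Z t)"
    and integrable_Z_square: "\<And>t. integrable M (\<lambda>x. (Z t x)\<^sup>2)"
    and mean_zero: "\<And>t. expectation (Z t) = 0"
    and variance_one: "\<And>t. variance (Z t) = 1"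
    and no_common_root: "\<not> (\<exists>z. lag_poly p a z = 0 \<and> lag_poly q b z = 0)"
    and no_root_in_disc: "\<And>z. norm z \<le> 1 \<Longrightarrow> lag_poly q b z \<noteq> 0"
    and coefficients: "\<And>z. norm z < 1 \<Longrightarrow>
      (\<lambda>k. complex_of_real (lam k) * z ^ k) sums
        (lag_poly p a z / lag_poly q b z * (1 - z) powr (- complex_of_real d))"
    and measurable_volatility: "\<And>t. random_variable borel (\<sigma> t)"
    and volatility_pos: "\<And>t x. x \<in> space M \<Longrightarrow> \<sigma> t x > 0"
    and log_volatility: "\<And>t. AE x in M.
      summable (\<lambda>k. lam k * news_impact M \<theta> \<gamma> (Z (t - 1 - int k)) x) \<and>
      ln ((\<sigma> t x)\<^sup>2) = \<omega> + (\<Sum>k. lam k * news_impact M \<theta> \<gamma> (Z (t - 1 - int k)) x)"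
    and process: "\<And>t x. x \<in> space M \<Longrightarrow> X t x = \<sigma> t x * Z t x"

definition past :: "'a measure \<Rightarrow> (int \<Rightarrow> 'a \<Rightarrow> real) \<Rightarrow> int \<Rightarrow> 'a measure" where
  "past M Z n = sigma (space M) (\<Union>t\<in>{..n}. {Z t -` A \<inter> space M | A. A \<in> sets borel})"

definition log_vol_forecast ::
  "'a measure \<Rightarrow> (int \<Rightarrow> 'a \<Rightarrow> real) \<Rightarrow> (int \<Rightarrow> 'a \<Rightarrow> real) \<Rightarrow> int \<Rightarrow> nat \<Rightarrow> 'a \<Rightarrow> real" where
  "log_vol_forecast M Z \<sigma> n h =
     real_cond_exp M (past M Z n) (\<lambda>x. ln ((\<sigma> (n + int h) x)\<^sup>2))"

end

theory Submission imports Defs begin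

text \<open>Split the log-volatility at time \<open>n + h\<close> into \<open>\<omega>\<close>, the finitely many terms with innovations
  after time \<open>n\<close>, and the remaining tail. The tail is measurable with respect to the past, the finite
  part is centred and independent of it, so the tail is the forecast and the finite part its error.
  The conditional expectation only makes sense if the log-volatility is integrable, although only
  almost sure convergence of the series is assumed: for i.i.d. centred nondegenerate summands
  with finite variance this convergence forces square summability of the weights, and Fatou's lemma
  then gives a square integrable limit.\<close>

subsection \<open>Series of independent random variables\<close>

context prob_space
begin

section \<open>Second moments of finite and infinite independent sums\<close>

text \<open>Variances add: in the induction the new summand is independent of the sum of the others,
  so the cross term has expectation 0.\<close>

lemma square_integrable_sum_indep:
  fixes Y :: "'b \<Rightarrow> 'a \<Rightarrow> real"
  assumes "finite I"
    and "indep_vars (\<lambda>_. borel) Y I"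
    and "\<And>i. i \<in> I \<Longrightarrow> integrable M (\<lambda>x. (Y i x)\<^sup>2)"
    and "\<And>i. i \<in> I \<Longrightarrow> expectation (Y i) = 0"
  shows "integrable M (\<lambda>x. (\<Sum>i\<in>I. Y i x)\<^sup>2) \<and>
    expectation (\<lambda>x. (\<Sum>i\<in>I. Y i x)\<^sup>2) = (\<Sum>i\<in>I. expectation (\<lambda>x. (Y i x)\<^sup>2))"
  using assms
proof (induction I rule: finite_induct)
  case empty
  then show ?case by simp
next
  case (insert i I)
  let ?S = "\<lambda>x. \<Sum>j\<in>I. Y j x"
  have rv: "random_variable borel (Y j)" if "j \<in> insert i I" for j
    using insert.prems(1) that unfolding indep_vars_def2 by blast
  have int: "integrable M (Y j)" if "j \<in> insert i I" for j
    by (rule square_integrable_imp_integrable[OF rv[OF that] insert.prems(2)[OF that]])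
  have intS: "integrable M ?S"
    using int by (intro Bochner_Integration.integrable_sum) auto
  have IH: "integrable M (\<lambda>x. (?S x)\<^sup>2)"
      "expectation (\<lambda>x. (?S x)\<^sup>2) = (\<Sum>j\<in>I. expectation (\<lambda>x. (Y j x)\<^sup>2))"
    using insert.IH insert.prems indep_vars_subset[OF insert.prems(1), of I] by auto
  have ind: "indep_var borel (Y i) borel ?S"
    using indep_vars_sum[OF insert.hyps insert.prems(1)] .
  have int_mult: "integrable M (\<lambda>x. Y i x * ?S x)"
    by (rule indep_var_integrable[OF ind int intS]) simp
  have prod_0: "expectation (\<lambda>x. Y i x * ?S x) = 0"
    using indep_var_lebesgue_integral[OF ind int intS] insert.prems(3)[of i] by simp
  have eq: "(\<Sum>j\<in>insert i I. Y j x)\<^sup>2 = (Y i x)\<^sup>2 + 2 * (Y i x * ?S x) + (?S x)\<^sup>2" for x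
    using insert.hyps by (simp add: power2_sum)
  show ?case
    unfolding eq using insert.hyps insert.prems(2)[of i] IH int_mult prod_0 by simp
qed

text \<open>Fatou's lemma applied to the squared partial sums, whose expectations are partial sums
  of the convergent series of variances.\<close>

lemma square_integrable_suminf_indep:
  fixes Y :: "nat \<Rightarrow> 'a \<Rightarrow> real"
  assumes indep: "indep_vars (\<lambda>_. borel) Y UNIV"
    and sq: "\<And>k. integrable M (\<lambda>x. (Y k x)\<^sup>2)"
    and mean: "\<And>k. expectation (Y k) = 0"
    and var: "summable (\<lambda>k. expectation (\<lambda>x. (Y k x)\<^sup>2))"
    and conv: "AE x in M. summable (\<lambda>k. Y k x)"
  shows "integrable M (\<lambda>x. (\<Sum>k. Y k x)\<^sup>2)"
proof -
  let ?S = "\<lambda>n x. \<Sum>k<n. Y k x" and ?v = "\<lambda>k. expectation (\<lambda>x. (Y k x)\<^sup>2)"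
  have rv[measurable]: "random_variable borel (Y k)" for k
    using indep unfolding indep_vars_def2 by blast
  have S: "integrable M (\<lambda>x. (?S n x)\<^sup>2)" "expectation (\<lambda>x. (?S n x)\<^sup>2) = (\<Sum>k<n. ?v k)" for n
    using square_integrable_sum_indep[of "{..<n}" Y] indep_vars_subset[OF indep, of "{..<n}"] sq mean
    by auto
  have "(\<integral>\<^sup>+x. ennreal ((\<Sum>k. Y k x)\<^sup>2) \<partial>M) = (\<integral>\<^sup>+x. liminf (\<lambda>n. ennreal ((?S n x)\<^sup>2)) \<partial>M)"
  proof (rule nn_integral_cong_AE)
    show "AE x in M. ennreal ((\<Sum>k. Y k x)\<^sup>2) = liminf (\<lambda>n. ennreal ((?S n x)\<^sup>2))"
      using conv
    proof eventually_elim
      case (elim x)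
      then have "(\<lambda>n. ennreal ((?S n x)\<^sup>2)) \<longlonglongrightarrow> ennreal ((\<Sum>k. Y k x)\<^sup>2)"
        by (intro tendsto_ennrealI tendsto_power summable_LIMSEQ)
      then show ?case
        by (intro lim_imp_Liminf[symmetric]) auto
    qed
  qed
  also have "\<dots> \<le> liminf (\<lambda>n. \<integral>\<^sup>+x. ennreal ((?S n x)\<^sup>2) \<partial>M)"
    by (rule nn_integral_liminf) measurable
  also have "\<dots> = liminf (\<lambda>n. ennreal (\<Sum>k<n. ?v k))"
    using S by (subst nn_integral_eq_integral) auto
  also have "\<dots> \<le> ennreal (\<Sum>k. ?v k)"
    by (intro Liminf_le) (auto intro!: always_eventually ennreal_leI sum_le_suminf var)
  finally show ?thesis
    by (intro integrableI_bounded) (auto simp: less_top[symmetric] top_unique)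
qed

section \<open>Characteristic functions and the weights of convergent series\<close>

lemma char_scale:
  fixes X :: "'a \<Rightarrow> real"
  assumes [measurable]: "random_variable borel X"
  shows "char (distr M borel (\<lambda>x. c * X x)) t = char (distr M borel X) (c * t)"
  unfolding char_def by (subst (1 2) integral_distr) (auto simp: ac_simps)

text \<open>With variance \<open>v\<close>, the characteristic function differs from
  \<open>1 - t^2 * v / 2\<close> by at most \<open>t^2 / 6 * e t\<close>, and \<open>e t\<close>
  tends to 0 with \<open>t\<close>. Near 0 the error therefore cannot use up the quadratic
  decay.\<close>

lemma char_le_exp_near_0:
  fixes X :: "'a \<Rightarrow> real"
  assumes [measurable]: "random_variable borel X"
    and sq: "integrable M (\<lambda>x. (X x)\<^sup>2)"
    and mean: "expectation X = 0"
    and var: "expectation (\<lambda>x. (X x)\<^sup>2) > 0"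
  obtains s where "s > 0"
    and "\<And>t. \<bar>t\<bar> \<le> s \<Longrightarrow>
      cmod (char (distr M borel X) t) \<le> exp (- (expectation (\<lambda>x. (X x)\<^sup>2) / 4 * t\<^sup>2))"
proof -
  define v where "v = expectation (\<lambda>x. (X x)\<^sup>2)"
  \<comment> \<open>This is the remainder of \<open>char_approx3'\<close>. The cap by
    \<open>6 * (X x)^2\<close> keeps it finite when only second moments exist.\<close>
  define e where "e t = expectation (\<lambda>x. min (6 * (X x)\<^sup>2) (\<bar>t\<bar> * \<bar>X x\<bar> ^ 3))" for t :: real
  have int: "integrable M X"
    by (rule square_integrable_imp_integrable[OF _ sq]) simp
  have int_e: "integrable M (\<lambda>x. min (6 * (X x)\<^sup>2) (\<bar>t\<bar> * \<bar>X x\<bar> ^ 3))" for t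
    by (rule Bochner_Integration.integrable_bound[of _ "\<lambda>x. 6 * (X x)\<^sup>2"]) (use sq in auto)
  \<comment> \<open>The sequence \<open>1 / (n + 1)\<close> suffices, because \<open>e t\<close> is
    monotone in the modulus of \<open>t\<close>.\<close>
  have "(\<lambda>n. expectation (\<lambda>x. min (6 * (X x)\<^sup>2) (inverse (real (Suc n)) * \<bar>X x\<bar> ^ 3)))
      \<longlonglongrightarrow> expectation (\<lambda>x. 0)"
  proof (rule integral_dominated_convergence[where w = "\<lambda>x. 6 * (X x)\<^sup>2"])
    have "(\<lambda>n. min (6 * (X x)\<^sup>2) (inverse (real (Suc n)) * \<bar>X x\<bar> ^ 3))
        \<longlonglongrightarrow> min (6 * (X x)\<^sup>2) (0 * \<bar>X x\<bar> ^ 3)" for x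
      by (intro tendsto_intros LIMSEQ_inverse_real_of_nat)
    then have "(\<lambda>n. min (6 * (X x)\<^sup>2) (inverse (real (Suc n)) * \<bar>X x\<bar> ^ 3)) \<longlonglongrightarrow> 0" for x
      by (simp only: mult_zero_left min_absorb2 zero_le_mult_iff zero_le_power2 zero_le_numeral simp_thms)
    then show "AE x in M. (\<lambda>n. min (6 * (X x)\<^sup>2) (inverse (real (Suc n)) * \<bar>X x\<bar> ^ 3)) \<longlonglongrightarrow> 0"
      by (intro AE_I2)
  qed (use sq in auto)
  then have "eventually (\<lambda>n. e (inverse (real (Suc n))) < v) sequentially"
    unfolding e_def using var by (auto simp: v_def intro!: order_tendstoD(2)[where y=0])
  then obtain n where n: "e (inverse (real (Suc n))) < v"
    by (auto simp: eventually_sequentially)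
  \<comment> \<open>The first bound gives \<open>e t\<close> at most \<open>v\<close>; the second
    gives \<open>t^2 * v\<close> at most 1, so that \<open>1 - t^2 * v / 2\<close> is nonnegative
    and equals its own modulus.\<close>
  define s where "s = min (inverse (real (Suc n))) (1 / sqrt v)"
  have v: "v > 0" using var by (simp add: v_def)
  have "s > 0" using v by (simp add: s_def)
  moreover have "cmod (char (distr M borel X) t) \<le> exp (- (v / 4 * t\<^sup>2))" if t: "\<bar>t\<bar> \<le> s" for t
  proof -
    have "e t \<le> e (inverse (real (Suc n)))"
      unfolding e_def using t by (intro integral_mono int_e min.mono mult_right_mono) (auto simp: s_def)
    then have e: "e t \<le> v" using n by simp
    have "t\<^sup>2 \<le> (1 / sqrt v)\<^sup>2"
      using t by (intro abs_le_square_iff[THEN iffD1]) (use v in \<open>auto simp: s_def\<close>)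
    then have t2: "t\<^sup>2 * v \<le> 1"
      using v by (simp add: power_divide field_simps)
    have "cmod (char (distr M borel X) t - (1 - t\<^sup>2 * v / 2)) \<le> t\<^sup>2 / 6 * e t"
      unfolding e_def
      by (rule char_approx3'[where X=X]) (use sq mean int in \<open>auto simp: v_def\<close>)
    also have "\<dots> \<le> t\<^sup>2 / 6 * v"
      by (intro mult_left_mono e) auto
    finally have 1: "cmod (char (distr M borel X) t - (1 - t\<^sup>2 * v / 2)) \<le> t\<^sup>2 * v / 6" by simp
    have "cmod (complex_of_real (1 - t\<^sup>2 * v / 2)) = 1 - t\<^sup>2 * v / 2"
      using t2 by (simp only: norm_of_real)
    then have "cmod (char (distr M borel X) t) \<le> (1 - t\<^sup>2 * v / 2) + t\<^sup>2 * v / 6"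
      using 1 norm_triangle_sub[of "char (distr M borel X) t" "complex_of_real (1 - t\<^sup>2 * v / 2)"]
      by linarith
    \<comment> \<open>The coefficient of \<open>t^2 * v\<close> is \<open>-1/2 + 1/6 = -1/3\<close>,
      which is below \<open>-1/4\<close>.\<close>
    also have "\<dots> \<le> 1 + - (v / 4 * t\<^sup>2)"
      using v by (simp add: field_simps)
    also have "\<dots> \<le> exp (- (v / 4 * t\<^sup>2))"
      by (rule exp_ge_add_one_self)
    finally show ?thesis .
  qed
  ultimately show ?thesis using that unfolding v_def by blast
qed

text \<open>The terms of a convergent series tend to 0, so the means of their truncated moduli do
  too. These means are an increasing function of the modulus of the weight that is positive at 1,
  hence the weights are eventually at most 1 in modulus. Boundedness later allows one argument
  \<open>t\<close> to serve all factors of a product of characteristic functions.\<close>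

lemma iid_series_bounded_weights:
  fixes W :: "nat \<Rightarrow> 'a \<Rightarrow> real" and c :: "nat \<Rightarrow> real"
  assumes [measurable]: "\<And>k. random_variable borel (W k)"
    and id: "\<And>k. distr M borel (W k) = distr M borel (W 0)"
    and nz: "\<not> (AE x in M. W 0 x = 0)"
    and conv: "AE x in M. summable (\<lambda>k. c k * W k x)"
  shows "\<exists>B. \<forall>k. \<bar>c k\<bar> \<le> B"
proof -
  \<comment> \<open>Truncating at 1 supplies the dominating function.\<close>
  define m where "m r = expectation (\<lambda>x. min 1 (r * \<bar>W 0 x\<bar>))" for r :: real
  have m_int: "integrable M (\<lambda>x. min 1 (r * \<bar>W 0 x\<bar>))" if "r \<ge> 0" for r
    by (rule Bochner_Integration.integrable_bound[of _ "\<lambda>x. 1::real"]) (use that in auto)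
  have "(\<lambda>k. expectation (\<lambda>x. min 1 (\<bar>c k\<bar> * \<bar>W k x\<bar>))) \<longlonglongrightarrow> expectation (\<lambda>x. 0)"
  proof (rule integral_dominated_convergence[where w = "\<lambda>x. 1"])
    show "AE x in M. (\<lambda>k. min 1 (\<bar>c k\<bar> * \<bar>W k x\<bar>)) \<longlonglongrightarrow> 0"
      using conv
    proof eventually_elim
      case (elim x)
      have "(\<lambda>k. min 1 \<bar>c k * W k x\<bar>) \<longlonglongrightarrow> min 1 \<bar>0\<bar>"
        by (intro tendsto_intros summable_LIMSEQ_zero elim)
      then show ?case by (simp add: abs_mult)
    qed
  qed auto
  moreover have "expectation (\<lambda>x. min 1 (\<bar>c k\<bar> * \<bar>W k x\<bar>)) = m \<bar>c k\<bar>" for k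
  proof -
    have "expectation (\<lambda>x. min 1 (\<bar>c k\<bar> * \<bar>W k x\<bar>)) =
        (\<integral>y. min 1 (\<bar>c k\<bar> * \<bar>y\<bar>) \<partial>distr M borel (W k))"
      by (subst integral_distr) auto
    also have "\<dots> = m \<bar>c k\<bar>"
      unfolding id[of k] m_def by (subst integral_distr) auto
    finally show ?thesis .
  qed
  ultimately have lim: "(\<lambda>k. m \<bar>c k\<bar>) \<longlonglongrightarrow> 0" by simp
  have "m 1 \<noteq> 0"
  proof
    assume "m 1 = 0"
    then have "AE x in M. min 1 (1 * \<bar>W 0 x\<bar>) = 0"
      unfolding m_def using m_int[of 1] by (subst (asm) integral_nonneg_eq_0_iff_AE) auto
    then have "AE x in M. W 0 x = 0"
      by eventually_elim (auto simp: min_def split: if_splits)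
    with nz show False by simp
  qed
  moreover have "m 1 \<ge> 0" unfolding m_def by (intro integral_nonneg_AE) auto
  ultimately have "eventually (\<lambda>k. m \<bar>c k\<bar> < m 1) sequentially"
    using lim by (intro order_tendstoD(2)) auto
  then obtain N where N: "\<And>k. k \<ge> N \<Longrightarrow> m \<bar>c k\<bar> < m 1"
    by (auto simp: eventually_sequentially)
  have "\<bar>c k\<bar> \<le> 1" if "k \<ge> N" for k
  proof (rule ccontr)
    assume "\<not> \<bar>c k\<bar> \<le> 1"
    then have "m 1 \<le> m \<bar>c k\<bar>"
      unfolding m_def by (intro integral_mono m_int min.mono mult_right_mono) auto
    with N[OF that] show False by simp
  qed
  then have "Bseq c"
    by (intro Bseq_eventually_mono[of c "\<lambda>_. 1::real"]) (auto simp: eventually_sequentially)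
  then show ?thesis by (auto simp: Bseq_def)
qed

text \<open>The characteristic functions of the partial sums converge to that of the limit, which is
  bounded away from 0 near 0, while each factor is at most \<open>exp (- v c\<^sub>k\<^sup>2 t\<^sup>2 / 4)\<close>.\<close>

lemma iid_series_square_summable_weights:
  fixes W :: "nat \<Rightarrow> 'a \<Rightarrow> real" and c :: "nat \<Rightarrow> real"
  assumes indep: "indep_vars (\<lambda>_. borel) W UNIV"
    and id: "\<And>k. distr M borel (W k) = distr M borel (W 0)"
    and sq: "integrable M (\<lambda>x. (W 0 x)\<^sup>2)"
    and mean: "expectation (W 0) = 0"
    and nz: "\<not> (AE x in M. W 0 x = 0)"
    and conv: "AE x in M. summable (\<lambda>k. c k * W k x)"
  shows "summable (\<lambda>k. (c k)\<^sup>2)"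
proof -
  have rv[measurable]: "random_variable borel (W k)" for k
    using indep unfolding indep_vars_def2 by blast
  define v where "v = expectation (\<lambda>x. (W 0 x)\<^sup>2)"
  have "v \<noteq> 0"
    using nz integral_nonneg_eq_0_iff_AE[OF sq] by (auto simp: v_def)
  moreover have "v \<ge> 0" by (simp add: v_def)
  ultimately have v: "v > 0" by simp
  obtain s where s: "s > 0"
      "\<And>t. \<bar>t\<bar> \<le> s \<Longrightarrow> cmod (char (distr M borel (W 0)) t) \<le> exp (- (v / 4 * t\<^sup>2))"
    using char_le_exp_near_0[OF rv sq mean] v unfolding v_def by metis
  obtain B where B: "\<And>k. \<bar>c k\<bar> \<le> B"
    using iid_series_bounded_weights[OF rv id nz conv] by auto
  define S where "S x = (\<Sum>k. c k * W k x)" for x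
  have [measurable]: "random_variable borel S" unfolding S_def by measurable
  interpret L: real_distribution "distr M borel S"
    by (rule real_distribution_distr) measurable
  let ?\<psi> = "char (distr M borel S)"
  \<comment> \<open>Continuity at 0, where the value is 1, keeps the modulus above 1/2 on a
    punctured neighbourhood.\<close>
  have "(?\<psi> \<longlongrightarrow> ?\<psi> 0) (at 0)"
    using L.isCont_char[of 0] by (simp add: isCont_def)
  then have "eventually (\<lambda>t. dist (?\<psi> t) (?\<psi> 0) < 1 / 2) (at 0)"
    by (rule tendstoD) simp
  then obtain r where r: "r > 0" "\<And>t. t \<noteq> 0 \<Longrightarrow> \<bar>t\<bar> < r \<Longrightarrow> dist (?\<psi> t) 1 < 1 / 2"
    by (auto simp: eventually_at L.char_zero)
  \<comment> \<open>The first bound puts \<open>t\<close> strictly inside the neighbourhood of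
    radius \<open>r\<close>; the second puts every \<open>c k * t\<close> into the range where the
    exponential bound holds.\<close>
  define t where "t = min (r / 2) (s / (\<bar>B\<bar> + 1))"
  have t: "t > 0" "t < r"
    using r(1) s(1) by (auto simp: t_def intro!: divide_pos_pos)
  have "t \<le> s / (\<bar>B\<bar> + 1)" by (simp add: t_def)
  then have t_le: "t * (\<bar>B\<bar> + 1) \<le> s"
    by (subst (asm) pos_le_divide_eq) auto
  have small: "\<bar>c k * t\<bar> \<le> s" for k
  proof -
    have "\<bar>c k * t\<bar> \<le> (\<bar>B\<bar> + 1) * t"
      unfolding abs_mult using B[of k] t(1) by (intro mult_mono) auto
    then show ?thesis using t_le by (simp add: mult.commute)
  qed
  have \<psi>: "cmod (?\<psi> t) > 1 / 2"
    using r(2)[of t] t norm_triangle_ineq2[of 1 "?\<psi> t"]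
    by (simp add: dist_norm norm_minus_commute)
  let ?S = "\<lambda>n x. \<Sum>k<n. c k * W k x"
  have "(\<lambda>n. expectation (\<lambda>x. iexp (t * ?S n x))) \<longlonglongrightarrow> expectation (\<lambda>x. iexp (t * S x))"
  proof (rule integral_dominated_convergence[where w = "\<lambda>x. 1"])
    show "AE x in M. (\<lambda>n. iexp (t * ?S n x)) \<longlonglongrightarrow> iexp (t * S x)"
      using conv
    proof eventually_elim
      case (elim x)
      then show ?case
        unfolding S_def by (intro tendsto_intros summable_LIMSEQ)
    qed
  qed auto
  moreover have "expectation (\<lambda>x. iexp (t * S x)) = ?\<psi> t"
    unfolding char_def by (subst integral_distr) auto
  moreover have "expectation (\<lambda>x. iexp (t * ?S n x)) = (\<Prod>k<n. char (distr M borel (W 0)) (c k * t))" for n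
  proof -
    have "expectation (\<lambda>x. iexp (t * ?S n x)) = char (distr M borel (?S n)) t"
      unfolding char_def by (subst integral_distr) auto
    also have "\<dots> = (\<Prod>k<n. char (distr M borel (\<lambda>x. c k * W k x)) t)"
      by (rule char_distr_sum, rule indep_vars_compose2[where X=W], rule indep_vars_subset[OF indep]) auto
    also have "\<dots> = (\<Prod>k<n. char (distr M borel (W 0)) (c k * t))"
      by (intro prod.cong refl) (subst char_scale, simp, subst id, simp)
    finally show ?thesis .
  qed
  ultimately have "(\<lambda>n. \<Prod>k<n. char (distr M borel (W 0)) (c k * t)) \<longlonglongrightarrow> ?\<psi> t" by simp
  then have "(\<lambda>n. cmod (\<Prod>k<n. char (distr M borel (W 0)) (c k * t))) \<longlonglongrightarrow> cmod (?\<psi> t)"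
    by (rule tendsto_norm)
  then have "eventually (\<lambda>n. cmod (\<Prod>k<n. char (distr M borel (W 0)) (c k * t)) > 1 / 2) sequentially"
    by (rule order_tendstoD(1)) (rule \<psi>)
  then obtain N where N: "\<And>n. n \<ge> N \<Longrightarrow> cmod (\<Prod>k<n. char (distr M borel (W 0)) (c k * t)) > 1 / 2"
    by (auto simp: eventually_sequentially)
  \<comment> \<open>The constant comes from solving \<open>1 / 2 <= exp (- v * t^2 / 4 * S)\<close>
    for the partial sum \<open>S\<close>.\<close>
  have bound: "(\<Sum>k<n. (c k)\<^sup>2) \<le> 4 * ln 2 / (v * t\<^sup>2)" for n
  proof -
    \<comment> \<open>The lower bound 1/2 holds only from \<open>N\<close> on; smaller
      \<open>n\<close> are covered because the sums of squares increase.\<close>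
    let ?m = "max n N"
    have "1 / 2 \<le> cmod (\<Prod>k<?m. char (distr M borel (W 0)) (c k * t))"
      using N[of ?m] by simp
    also have "\<dots> \<le> (\<Prod>k<?m. exp (- (v / 4 * (c k * t)\<^sup>2)))"
      unfolding prod_norm[symmetric] by (intro prod_mono conjI norm_ge_zero s(2) small)
    also have "\<dots> = exp (- (v * t\<^sup>2 / 4 * (\<Sum>k<?m. (c k)\<^sup>2)))"
    proof -
      have "- (v / 4 * (c k * t)\<^sup>2) = - (v * t\<^sup>2 / 4) * (c k)\<^sup>2" for k
        by (simp add: power_mult_distrib)
      then show ?thesis
        by (simp only: exp_sum[symmetric] finite_lessThan sum_distrib_left[symmetric] sum_negf mult_minus_left)
    qed
    finally have "ln (1 / 2) \<le> ln (exp (- (v * t\<^sup>2 / 4 * (\<Sum>k<?m. (c k)\<^sup>2))))"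
      by (subst ln_le_cancel_iff) auto
    then have "ln (1 / 2) \<le> - (v * t\<^sup>2 / 4 * (\<Sum>k<?m. (c k)\<^sup>2))"
      by (simp only: ln_exp)
    then have "(\<Sum>k<?m. (c k)\<^sup>2) \<le> 4 * ln 2 / (v * t\<^sup>2)"
      using v t(1) by (simp add: ln_div field_simps)
    moreover have "(\<Sum>k<n. (c k)\<^sup>2) \<le> (\<Sum>k<?m. (c k)\<^sup>2)"
      by (intro sum_mono2) auto
    ultimately show ?thesis by simp
  qed
  show ?thesis
    by (rule summableI_nonneg_bounded[OF _ bound]) simp
qed

section \<open>Conditional expectation under independence\<close>

text \<open>The indicator of any event of \<open>F\<close> is independent of \<open>f\<close>, so
  the integral of \<open>f\<close> over the event factorises, and this characterises the conditional
  expectation as a constant.\<close>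

lemma real_cond_exp_indep_set:
  fixes f :: "'a \<Rightarrow> real"
  assumes sub: "subalgebra M F"
    and f: "integrable M f"
    and indep: "indep_set (sets F) (sigma_sets (space M) {f -` A \<inter> space M | A. A \<in> sets borel})"
  shows "AE x in M. real_cond_exp M F f x = expectation f"
proof -
  interpret F: finite_measure_subalgebra M F
    by unfold_locales (rule sub)
  show ?thesis
  proof (rule F.real_cond_exp_charact)
    fix A assume A: "A \<in> sets F"
    then have AM[measurable]: "A \<in> sets M" using sub by (auto simp: subalgebra_def)
    have [measurable]: "(indicator A :: 'a \<Rightarrow> real) \<in> borel_measurable F"
      using A by simp
    \<comment> \<open>The indicator generates a sub-sigma-algebra of \<open>F\<close>, so it
      inherits the independence from \<open>f\<close>.\<close>
    have "sigma_sets (space M) {indicator A -` B \<inter> space M | B. B \<in> sets (borel::real measure)} \<subseteq> sets F"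
    proof -
      have "space F = space M" using sub by (simp add: subalgebra_def)
      then have "{indicator A -` B \<inter> space M | B. B \<in> sets (borel::real measure)} \<subseteq> sets F"
        using measurable_sets[OF \<open>(indicator A :: 'a \<Rightarrow> real) \<in> borel_measurable F\<close>] by auto
      then show ?thesis
        using sets.sigma_sets_subset[of _ F] \<open>space F = space M\<close> by simp
    qed
    then have "indep_set (sigma_sets (space M) {indicator A -` B \<inter> space M | B. B \<in> sets (borel::real measure)})
        (sigma_sets (space M) {f -` A \<inter> space M | A. A \<in> sets borel})"
      using indep unfolding indep_sets2_eq by blast
    then have "indep_var borel (indicator A :: 'a \<Rightarrow> real) borel f"
      unfolding indep_var_eq using f by auto
    then have "expectation (\<lambda>x. indicator A x * f x) = expectation (indicator A) * expectation f"
      using f by (intro indep_var_lebesgue_integral) (auto simp: emeasure_eq_measure)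
    then show "(\<integral>x\<in>A. f x \<partial>M) = (\<integral>x\<in>A. expectation f \<partial>M)"
      by (simp add: set_lebesgue_integral_def)
  qed (use f in auto)
qed

end

subsection \<open>The FIEGARCH process\<close>

lemma past_subalgebra:
  assumes "\<And>t. Z t \<in> borel_measurable M"
  shows "subalgebra M (past M Z n)"
    and "t \<le> n \<Longrightarrow> Z t \<in> borel_measurable (past M Z n)"
    and "sets (past M Z n) =
      sigma_sets (space M) (\<Union>t\<in>{..n}. {Z t -` A \<inter> space M | A. A \<in> sets borel})"
proof -
  let ?E = "\<Union>t\<in>{..n}. {Z t -` A \<inter> space M | A. A \<in> sets borel}"
  have sub: "?E \<subseteq> sets M"
    using measurable_sets[OF assms] by auto
  then have E: "?E \<subseteq> Pow (space M)"
    using sets.sets_into_space by blast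
  then show sets: "sets (past M Z n) = sigma_sets (space M) ?E"
    unfolding past_def by (rule sets_measure_of)
  have space: "space (past M Z n) = space M"
    unfolding past_def using E by (rule space_measure_of)
  show "subalgebra M (past M Z n)"
    unfolding subalgebra_def sets space using sets.sigma_sets_subset[OF sub] by simp
  show "Z t \<in> borel_measurable (past M Z n)" if "t \<le> n"
  proof (rule measurableI)
    fix A :: "real set" assume "A \<in> sets borel"
    then show "Z t -` A \<inter> space (past M Z n) \<in> sets (past M Z n)"
      unfolding sets space using that by (intro sigma_sets.Basic) blast
  qed simp
qed

context fiegarch
begin

section \<open>Moments and independence of the news impact\<close>

abbreviation G :: "int \<Rightarrow> 'a \<Rightarrow> real" where
  "G t \<equiv> news_impact M \<theta> \<gamma> (Z t)"

lemma rv_Z [measurable]: "random_variable borel (Z t)"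
  using independent unfolding indep_vars_def2 by blast

lemma rv_G [measurable]: "random_variable borel (G t)"
  unfolding news_impact_def by measurable

lemma expectation_Z_cong:
  assumes [measurable]: "(f :: real \<Rightarrow> real) \<in> borel_measurable borel"
  shows "expectation (\<lambda>x. f (Z t x)) = expectation (\<lambda>x. f (Z 0 x))"
proof -
  have "expectation (\<lambda>x. f (Z t x)) = (\<integral>y. f y \<partial>distr M borel (Z t))"
    by (subst integral_distr) auto
  also have "\<dots> = expectation (\<lambda>x. f (Z 0 x))"
    unfolding identically_distributed[of t 0] by (subst integral_distr) auto
  finally show ?thesis .
qed

text \<open>By identical distribution the centring constant can be taken at index 0. Each
  \<open>G t\<close> thus is the same function of its \<open>Z t\<close>, which makes the
  \<open>G t\<close> i.i.d.\<close>

lemma G_eq: "G t x = \<theta> * Z t x + \<gamma> * (\<bar>Z t x\<bar> - expectation (\<lambda>y. \<bar>Z 0 y\<bar>))"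
  unfolding news_impact_def using expectation_Z_cong[of abs t] by simp

lemma distr_G: "distr M borel (G t) = distr M borel (G s)"
proof -
  let ?f = "\<lambda>z. \<theta> * z + \<gamma> * (\<bar>z\<bar> - expectation (\<lambda>y. \<bar>Z 0 y\<bar>))"
  have "distr M borel (G t) = distr (distr M borel (Z t)) borel ?f" for t
    by (subst distr_distr) (auto simp: G_eq[abs_def] comp_def)
  then show ?thesis using identically_distributed[of t s] by simp
qed

lemma integrable_abs_Z: "integrable M (\<lambda>x. \<bar>Z t x\<bar>)"
  using integrable_Z by simp

lemma integrable_G: "integrable M (G t)"
  unfolding news_impact_def using integrable_Z[of t] integrable_abs_Z[of t] by simp

lemma expectation_G: "expectation (G t) = 0"
  unfolding news_impact_def using integrable_Z[of t] integrable_abs_Z[of t] mean_zero[of t]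
  by (simp add: prob_space)

text \<open>Expand the square and use that the squares of \<open>Z t\<close> and of its modulus
  agree. The term linear in \<open>Z t\<close> has mean 0; the term linear in the modulus and the
  constant combine to minus the squared product of \<gamma> and the mean modulus.\<close>

lemma
  shows integrable_G_square: "integrable M (\<lambda>x. (G t x)\<^sup>2)"
    and expectation_G_square: "expectation (\<lambda>x. (G t x)\<^sup>2) =
      \<theta>\<^sup>2 + \<gamma>\<^sup>2 - (\<gamma> * expectation (\<lambda>x. \<bar>Z 0 x\<bar>))\<^sup>2 + 2 * \<theta> * \<gamma> * expectation (\<lambda>x. Z 0 x * \<bar>Z 0 x\<bar>)"
proof -
  let ?m = "expectation (\<lambda>x. \<bar>Z 0 x\<bar>)"
  have int: "integrable M (\<lambda>x. Z t x * \<bar>Z t x\<bar>)"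
    by (rule Bochner_Integration.integrable_bound[OF integrable_Z_square[of t]])
      (auto simp: power2_eq_square abs_mult)
  note ints = int integrable_Z_square[of t] integrable_Z[of t] integrable_abs_Z[of t]
  have eq: "(G t x)\<^sup>2 = (\<theta>\<^sup>2 + \<gamma>\<^sup>2) * (Z t x)\<^sup>2 + 2 * \<theta> * \<gamma> * (Z t x * \<bar>Z t x\<bar>)
      - 2 * \<theta> * \<gamma> * ?m * Z t x - 2 * \<gamma>\<^sup>2 * ?m * \<bar>Z t x\<bar> + \<gamma>\<^sup>2 * ?m\<^sup>2" for x
  proof -
    have "\<bar>Z t x\<bar> * \<bar>Z t x\<bar> = Z t x * Z t x" by simp
    then show ?thesis
      unfolding G_eq power2_eq_square by algebra
  qed
  show "integrable M (\<lambda>x. (G t x)\<^sup>2)"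
    unfolding eq using ints by simp
  have v: "expectation (\<lambda>x. (Z t x)\<^sup>2) = 1"
    using variance_one[of t] mean_zero[of t] by simp
  have "expectation (\<lambda>x. (G t x)\<^sup>2) = (\<theta>\<^sup>2 + \<gamma>\<^sup>2) + 2 * \<theta> * \<gamma> * expectation (\<lambda>x. Z t x * \<bar>Z t x\<bar>)
      - 2 * \<gamma>\<^sup>2 * ?m * expectation (\<lambda>x. \<bar>Z t x\<bar>) + \<gamma>\<^sup>2 * ?m\<^sup>2"
    unfolding eq using ints v mean_zero[of t] by (simp add: prob_space)
  also have "expectation (\<lambda>x. Z t x * \<bar>Z t x\<bar>) = expectation (\<lambda>x. Z 0 x * \<bar>Z 0 x\<bar>)"
    using expectation_Z_cong[of "\<lambda>z. z * \<bar>z\<bar>" t] by simp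
  also have "expectation (\<lambda>x. \<bar>Z t x\<bar>) = ?m"
    using expectation_Z_cong[of abs t] by simp
  finally show "expectation (\<lambda>x. (G t x)\<^sup>2) =
      \<theta>\<^sup>2 + \<gamma>\<^sup>2 - (\<gamma> * ?m)\<^sup>2 + 2 * \<theta> * \<gamma> * expectation (\<lambda>x. Z 0 x * \<bar>Z 0 x\<bar>)"
    by (simp add: power2_eq_square algebra_simps)
qed

text \<open>Distinct \<open>k\<close> use disjoint singleton blocks of the independent family
  \<open>Z\<close>. The free weights \<open>c\<close> cover both the terms of the series
  (\<open>lam\<close>) and the bare \<open>G\<close> (constant 1).\<close>

lemma indep_vars_scaled_G:
  "indep_vars (\<lambda>_. borel) (\<lambda>k x. c k * G (t - int k) x) UNIV"
proof -
  have ind: "indep_vars (\<lambda>j. PiM {t - int j} (\<lambda>_. borel)) (\<lambda>j x. restrict (\<lambda>i. Z i x) {t - int j}) UNIV"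
    by (rule indep_vars_restrict[OF independent]) (auto simp: disjoint_family_on_def)
  have "indep_vars (\<lambda>_. borel) (\<lambda>k x. (\<lambda>f. c k * (\<theta> * f (t - int k) + \<gamma> * (\<bar>f (t - int k)\<bar>
      - expectation (\<lambda>y. \<bar>Z 0 y\<bar>)))) (restrict (\<lambda>i. Z i x) {t - int k})) UNIV"
    by (rule indep_vars_compose2[OF ind]) simp
  then show ?thesis by (simp add: G_eq)
qed

section \<open>Integrability of the log-volatility\<close>

text \<open>If the news impact vanishes almost surely, for instance when \<theta> and \<gamma> are
  0, all variances in the series are 0. Otherwise its almost sure convergence makes
  \<open>lam\<close> square summable. In both cases the variances are summable.\<close>

lemma integrable_log_vol: "integrable M (\<lambda>x. ln ((\<sigma> t x)\<^sup>2))"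
proof -
  let ?Y = "\<lambda>k x. lam k * G (t - 1 - int k) x"
  have conv: "AE x in M. summable (\<lambda>k. ?Y k x)"
    using log_volatility[of t] by eventually_elim simp
  have var: "expectation (\<lambda>x. (?Y k x)\<^sup>2) = (lam k)\<^sup>2 * expectation (\<lambda>x. (G 0 x)\<^sup>2)" for k
    by (simp add: power_mult_distrib expectation_G_square)
  have "summable (\<lambda>k. expectation (\<lambda>x. (?Y k x)\<^sup>2))"
  proof (cases "AE x in M. G (t - 1) x = 0")
    case True
    then have "expectation (\<lambda>x. (G (t - 1) x)\<^sup>2) = 0"
      by (subst integral_nonneg_eq_0_iff_AE[OF integrable_G_square]) auto
    then have "expectation (\<lambda>x. (G 0 x)\<^sup>2) = 0"
      by (simp add: expectation_G_square)
    then show ?thesis unfolding var by simp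
  next
    case False
    have "summable (\<lambda>k. (lam k)\<^sup>2)"
    proof (rule iid_series_square_summable_weights[where W = "\<lambda>k. G (t - 1 - int k)"])
      show "indep_vars (\<lambda>_. borel) (\<lambda>k. G (t - 1 - int k)) UNIV"
        using indep_vars_scaled_G[of "\<lambda>_. 1" "t - 1"] by simp
      show "distr M borel (G (t - 1 - int k)) = distr M borel (G (t - 1 - int 0))" for k
        by (rule distr_G)
    qed (use False conv in \<open>simp_all add: integrable_G_square expectation_G\<close>)
    then show ?thesis unfolding var by (rule summable_mult2)
  qed
  then have "integrable M (\<lambda>x. (\<Sum>k. ?Y k x)\<^sup>2)"
    using conv by (intro square_integrable_suminf_indep indep_vars_scaled_G)
      (auto simp: power_mult_distrib integrable_G_square expectation_G)
  then have "integrable M (\<lambda>x. \<Sum>k. ?Y k x)"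
    by (rule square_integrable_imp_integrable[rotated]) measurable
  then have "integrable M (\<lambda>x. \<omega> + (\<Sum>k. ?Y k x))" by simp
  moreover have "AE x in M. \<omega> + (\<Sum>k. ?Y k x) = ln ((\<sigma> t x)\<^sup>2)"
    using log_volatility[of t] by eventually_elim simp
  ultimately show ?thesis
    using measurable_volatility[of t] by (subst (asm) integrable_cong_AE) auto
qed

section \<open>The forecast and its mean square error\<close>

text \<open>The index sets \<open>{..n}\<close> and \<open>{s}\<close> are disjoint, so the
  sigma-algebras that they generate are independent; \<open>G s\<close> is a function of
  \<open>Z s\<close> and has mean 0.\<close>

lemma real_cond_exp_future_G:
  assumes "n < s"
  shows "AE x in M. real_cond_exp M (past M Z n) (G s) x = 0"
proof -
  let ?E = "\<lambda>t. {Z t -` A \<inter> space M | A. A \<in> sets borel}"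
  have "indep_sets ?E UNIV"
    using independent unfolding indep_vars_def2 by simp
  \<comment> \<open>The two groups of indices are coded as a family over \<open>bool\<close>, with
    \<open>True\<close> for the past.\<close>
  then have "indep_sets (\<lambda>b. sigma_sets (space M) (\<Union>t\<in>case_bool {..n} {s} b. ?E t)) UNIV"
  proof (intro indep_sets_collect_sigma)
    show "Int_stable (?E t)" for t
    proof (rule Int_stableI)
      fix a b assume "a \<in> ?E t" "b \<in> ?E t"
      then obtain A B where "a = Z t -` A \<inter> space M" "b = Z t -` B \<inter> space M"
        "A \<in> sets borel" "B \<in> sets borel" by auto
      then show "a \<inter> b \<in> ?E t"
        by (intro CollectI exI[of _ "A \<inter> B"]) auto
    qed
    show "disjoint_family_on (case_bool {..n} {s}) UNIV"
      using assms by (auto simp: disjoint_family_on_def split: bool.splits)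
  qed (rule indep_sets_mono_index, auto)
  then have ind: "indep_set (sets (past M Z n)) (sigma_sets (space M) (?E s))"
    unfolding indep_set_def past_subalgebra(3)[where Z=Z, OF rv_Z]
    by (rule indep_sets_mono_sets) (auto split: bool.splits)
  have "{G s -` A \<inter> space M | A. A \<in> sets borel} \<subseteq> ?E s"
  proof safe
    fix A :: "real set" assume A: "A \<in> sets borel"
    let ?f = "\<lambda>z. \<theta> * z + \<gamma> * (\<bar>z\<bar> - expectation (\<lambda>y. \<bar>Z 0 y\<bar>))"
    have "?f \<in> borel_measurable borel" by measurable
    then have "?f -` A \<in> sets borel" using A by (metis measurable_sets_borel)
    then show "\<exists>B. G s -` A \<inter> space M = Z s -` B \<inter> space M \<and> B \<in> sets borel"
      by (intro exI[of _ "?f -` A"]) (auto simp: G_eq)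
  qed
  then have "sigma_sets (space M) {G s -` A \<inter> space M | A. A \<in> sets borel} \<subseteq> sigma_sets (space M) (?E s)"
    by (rule sigma_sets_mono')
  with ind have "indep_set (sets (past M Z n)) (sigma_sets (space M) {G s -` A \<inter> space M | A. A \<in> sets borel})"
    unfolding indep_sets2_eq by blast
  from real_cond_exp_indep_set[OF past_subalgebra(1)[where Z=Z, OF rv_Z] integrable_G this]
  show ?thesis by (simp add: expectation_G)
qed

lemma log_vol_forecast:
  assumes "h > 0"
  shows "AE x in M. summable (\<lambda>k. lam (k + (h - 1)) * G (n - int k) x) \<and>
      log_vol_forecast M Z \<sigma> n h x = \<omega> + (\<Sum>k. lam (k + (h - 1)) * G (n - int k) x) \<and>
      ln ((\<sigma> (n + int h) x)\<^sup>2) - log_vol_forecast M Z \<sigma> n h x =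
        (\<Sum>k<h - 1. lam k * G (n + int h - 1 - int k) x)"
proof -
  let ?L = "\<lambda>x. ln ((\<sigma> (n + int h) x)\<^sup>2)"
  let ?Y = "\<lambda>k x. lam k * G (n + int h - 1 - int k) x"
  let ?H = "\<lambda>x. \<Sum>k<h - 1. ?Y k x"
  let ?T = "\<lambda>x. \<omega> + (\<Sum>k. lam (k + (h - 1)) * G (n - int k) x)"
  let ?F = "past M Z n"
  note sub = past_subalgebra[where Z=Z and n=n, OF rv_Z]
  interpret F: finite_measure_subalgebra M ?F
    by unfold_locales (rule sub(1))
  have split: "AE x in M. summable (\<lambda>k. lam (k + (h - 1)) * G (n - int k) x) \<and> ?L x = ?T x + ?H x"
    using log_volatility[of "n + int h"]
  proof eventually_elim
    case (elim x)
    \<comment> \<open>After the shift by \<open>h - 1\<close> the innovation has time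
      \<open>n - k\<close>. The assumption \<open>h > 0\<close> rules out truncation in
      \<open>h - 1\<close>.\<close>
    have idx: "?Y (k + (h - 1)) x = lam (k + (h - 1)) * G (n - int k) x" for k
      using assms by (simp add: of_nat_diff)
    show ?case
      using elim summable_iff_shift[of "\<lambda>k. ?Y k x" "h - 1"]
        suminf_split_initial_segment[of "\<lambda>k. ?Y k x" "h - 1"]
      unfolding idx by simp
  qed
  have [measurable]: "G t \<in> borel_measurable ?F" if "t \<le> n" for t
    using sub(2)[OF that] unfolding news_impact_def by measurable
  \<comment> \<open>Only times \<open>n - k\<close>, none after \<open>n\<close>, occur in the
    tail.\<close>
  have T_F: "?T \<in> borel_measurable ?F"
    by (intro borel_measurable_add borel_measurable_suminf borel_measurable_times) auto
  have T_M[measurable]: "?T \<in> borel_measurable M" by measurable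
  have int_Y: "integrable M (?Y k)" for k
    using integrable_G by simp
  have int_H: "integrable M ?H"
    using int_Y by (intro Bochner_Integration.integrable_sum)
  have L_rv[measurable]: "?L \<in> borel_measurable M"
    using measurable_volatility by measurable
  \<comment> \<open>The tail inherits integrability as the log-volatility minus a finite
    sum.\<close>
  have "integrable M (\<lambda>x. ?L x - ?H x)"
    using integrable_log_vol int_H by (rule Bochner_Integration.integrable_diff)
  moreover have "AE x in M. ?L x - ?H x = ?T x"
    using split by eventually_elim simp
  ultimately have int_T: "integrable M ?T"
    by (subst (asm) integrable_cong_AE) auto
  have 1: "AE x in M. real_cond_exp M ?F ?L x = real_cond_exp M ?F (\<lambda>x. ?T x + ?H x) x"
    by (rule F.real_cond_exp_cong) (use split in auto)
  have 2: "AE x in M. real_cond_exp M ?F (\<lambda>x. ?T x + ?H x) x =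
      real_cond_exp M ?F ?T x + real_cond_exp M ?F ?H x"
    by (rule F.real_cond_exp_add[OF int_T int_H])
  have 3: "AE x in M. real_cond_exp M ?F ?T x = ?T x"
    by (rule F.real_cond_exp_F_meas[OF int_T T_F])
  have 4: "AE x in M. real_cond_exp M ?F ?H x = (\<Sum>k<h - 1. real_cond_exp M ?F (?Y k) x)"
    by (rule F.real_cond_exp_sum[OF int_Y])
  \<comment> \<open>For \<open>k < h - 1\<close> the innovation time \<open>n + h - 1 - k\<close>
    lies after \<open>n\<close>.\<close>
  have "AE x in M. \<forall>k\<in>{..<h - 1}. real_cond_exp M ?F (?Y k) x = 0"
  proof (rule AE_finite_allI)
    fix k assume "k \<in> {..<h - 1}"
    then have "AE x in M. real_cond_exp M ?F (G (n + int h - 1 - int k)) x = 0"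
      by (intro real_cond_exp_future_G) auto
    with F.real_cond_exp_cmult[OF integrable_G, of "lam k" "n + int h - 1 - int k"]
    show "AE x in M. real_cond_exp M ?F (?Y k) x = 0"
      by eventually_elim simp
  qed simp
  with split 1 2 3 4 show ?thesis
    unfolding log_vol_forecast_def by eventually_elim simp
qed

text \<open>The forecast error is a sum of \<open>h - 1\<close> independent centred terms, so its
  second moment is the sum of theirs. For \<open>h = 1\<close> the sum is empty.\<close>

lemma log_vol_forecast_mse:
  assumes "h > 0"
  shows "integrable M (\<lambda>x. (ln ((\<sigma> (n + int h) x)\<^sup>2) - log_vol_forecast M Z \<sigma> n h x)\<^sup>2)"
    and "expectation (\<lambda>x. (ln ((\<sigma> (n + int h) x)\<^sup>2) - log_vol_forecast M Z \<sigma> n h x)\<^sup>2) =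
      expectation (\<lambda>x. (G 0 x)\<^sup>2) * (\<Sum>k<h - 1. (lam k)\<^sup>2)"
proof -
  let ?D = "\<lambda>x. (ln ((\<sigma> (n + int h) x)\<^sup>2) - log_vol_forecast M Z \<sigma> n h x)\<^sup>2"
  let ?Y = "\<lambda>k x. lam k * G (n + int h - 1 - int k) x"
  have "?D \<in> borel_measurable M"
    unfolding log_vol_forecast_def using measurable_volatility by measurable
  moreover have "AE x in M. ?D x = (\<Sum>k<h - 1. ?Y k x)\<^sup>2"
    using log_vol_forecast[OF assms, of n] by eventually_elim (drule conjunct2, drule conjunct2, simp only:)
  moreover have "integrable M (\<lambda>x. (\<Sum>k<h - 1. ?Y k x)\<^sup>2) \<and>
      expectation (\<lambda>x. (\<Sum>k<h - 1. ?Y k x)\<^sup>2) = (\<Sum>k<h - 1. expectation (\<lambda>x. (?Y k x)\<^sup>2))"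
    by (intro square_integrable_sum_indep indep_vars_subset[OF indep_vars_scaled_G])
      (auto simp: power_mult_distrib integrable_G_square expectation_G)
  moreover have "(\<Sum>k<h - 1. expectation (\<lambda>x. (?Y k x)\<^sup>2)) =
      expectation (\<lambda>x. (G 0 x)\<^sup>2) * (\<Sum>k<h - 1. (lam k)\<^sup>2)"
    by (simp add: power_mult_distrib expectation_G_square sum_distrib_right[symmetric] mult.commute)
  ultimately show "integrable M ?D"
    and "expectation ?D = expectation (\<lambda>x. (G 0 x)\<^sup>2) * (\<Sum>k<h - 1. (lam k)\<^sup>2)"
    using integrable_cong_AE[of ?D M "\<lambda>x. (\<Sum>k<h - 1. ?Y k x)\<^sup>2"]
      integral_cong_AE[of ?D M "\<lambda>x. (\<Sum>k<h - 1. ?Y k x)\<^sup>2"] by auto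
qed

end

theorem proposition4:
  fixes M :: "'a measure"
    and p q n :: nat
    and d \<omega> \<theta> \<gamma> :: real
    and a b lam :: "nat \<Rightarrow> real"
    and Z \<sigma> X :: "int \<Rightarrow> 'a \<Rightarrow> real"
  assumes "fiegarch M p d q \<omega> \<theta> \<gamma> a b lam Z \<sigma> X"
  defines "sg2 \<equiv> \<integral>x. (news_impact M \<theta> \<gamma> (Z 0) x)\<^sup>2 \<partial>M"
  shows "(\<forall>h::nat. h > 0 \<longrightarrow>
           integrable M (\<lambda>x. ln ((\<sigma> (int n + int h) x)\<^sup>2)) \<and>
           (AE x in M.
              summable (\<lambda>k. lam (k + h - 1) * news_impact M \<theta> \<gamma> (Z (int n - int k)) x) \<and>
              log_vol_forecast M Z \<sigma> (int n) h x =
                \<omega> + (\<Sum>k. lam (k + h - 1) * news_impact M \<theta> \<gamma> (Z (int n - int k)) x)) \<and>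
           integrable M (\<lambda>x. (ln ((\<sigma> (int n + int h) x)\<^sup>2) - log_vol_forecast M Z \<sigma> (int n) h x)\<^sup>2) \<and>
           (h = 1 \<longrightarrow>
              (\<integral>x. (ln ((\<sigma> (int n + int h) x)\<^sup>2) - log_vol_forecast M Z \<sigma> (int n) h x)\<^sup>2 \<partial>M) = 0) \<and>
           (h \<ge> 2 \<longrightarrow>
              (\<integral>x. (ln ((\<sigma> (int n + int h) x)\<^sup>2) - log_vol_forecast M Z \<sigma> (int n) h x)\<^sup>2 \<partial>M) =
                sg2 * (\<Sum>k=0..h-2. (lam k)\<^sup>2))) \<and>
         sg2 = \<theta>\<^sup>2 + \<gamma>\<^sup>2 - (\<gamma> * (\<integral>x. \<bar>Z 0 x\<bar> \<partial>M))\<^sup>2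
                 + 2 * \<theta> * \<gamma> * (\<integral>x. Z 0 x * \<bar>Z 0 x\<bar> \<partial>M)"
proof -
  interpret fiegarch M p d q \<omega> \<theta> \<gamma> a b lam Z \<sigma> X by (rule assms(1))
  show ?thesis
  proof (intro conjI allI impI)
    fix h :: nat assume h: "h > 0"
    then have idx: "k + h - 1 = k + (h - 1)" for k by simp
    show "integrable M (\<lambda>x. ln ((\<sigma> (int n + int h) x)\<^sup>2))"
      by (rule integrable_log_vol)
    show "AE x in M. summable (\<lambda>k. lam (k + h - 1) * G (int n - int k) x) \<and>
        log_vol_forecast M Z \<sigma> (int n) h x = \<omega> + (\<Sum>k. lam (k + h - 1) * G (int n - int k) x)"
      unfolding idx using log_vol_forecast[OF h, of "int n"] by eventually_elim blast
    let ?D = "\<lambda>x. (ln ((\<sigma> (int n + int h) x)\<^sup>2) - log_vol_forecast M Z \<sigma> (int n) h x)\<^sup>2"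
    show "integrable M ?D"
      by (rule log_vol_forecast_mse(1)[OF h])
    show "expectation ?D = 0" if "h = 1"
      using log_vol_forecast_mse(2)[OF h, of "int n"] that by simp
    show "expectation ?D = sg2 * (\<Sum>k = 0..h - 2. (lam k)\<^sup>2)" if "h \<ge> 2"
    proof -
      \<comment> \<open>This needs \<open>h >= 2\<close>: at \<open>h = 1\<close> the truncated
        \<open>h - 2\<close> would leave the index 0 in the left-hand set.\<close>
      have "{0..h - 2} = {..<h - 1}" using that by auto
      then show ?thesis
        using log_vol_forecast_mse(2)[OF h, of "int n"] by (simp only: sg2_def)
    qed
  next
    show "sg2 = \<theta>\<^sup>2 + \<gamma>\<^sup>2 - (\<gamma> * expectation (\<lambda>x. \<bar>Z 0 x\<bar>))\<^sup>2
        + 2 * \<theta> * \<gamma> * expectation (\<lambda>x. Z 0 x * \<bar>Z 0 x\<bar>)"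
      unfolding sg2_def by (rule expectation_G_square)
  qed
qed

end
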